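(* Let $a,b,m,n$ be integers with $a,b\ge2$, $m\ge a+1$, $n\ge b+1$. The generic tensor product of the uniform matroids $U_{m-a,m}$ and $U_{n-b,n}$ is their freest linearly representable matroid tensor product; that is, the generic tensor product $T$ is a linearly representable tensor product of $U_{m-a,m}$ and $U_{n-b,n}$, and every tensor product $M$ of $U_{m-a,m}$ and $U_{n-b,n}$ that is representable over some field satisfies $M\preceq T$.
   Context: $U_{k,m}$ is the uniform matroid of rank $k$ on $[m]$. Weak order: for matroids $M,N$ on a common ground set, $M\preceq N$ ("$N$ is freer than $M$") means that every independent set of $M$ is independent in $N$. A matroid is linearly representable if it is representable over some field. Tensor product: let $M_1,M_2$ be loopless matroids on ground sets $E_1,E_2$. A matroid $M$ on $E_1\times E_2$ is a tensor product of $M_1$ and $M_2$ if (P1) for every $e_1\in E_1$ the restriction of $M$ to $\{e_1\}\times E_2$ is isomorphic to $M_2$ via $(e_1,e_2)\mapsto e_2$, and for every $e_2\in E_2$ the restriction of $M$ to $E_1\times\{e_2\}$ is isomorphic to $M_1$ via $(e_1,e_2)\mapsto e_1$; and (P2') $r_M(X_1\times X_2)=r_{M_1}(X_1)\,r_{M_2}(X_2)$ for all $X_1\subseteq E_1$, $X_2\subseteq E_2$. Generic tensor product (characteristic $0$): let $K$ be the field of rational functions over $\mathbb Q$ in jointly algebraically independent indeterminates which are the coordinates of vectors $u_1,\dots,u_m\in K^{m-a}$ and $v_1,\dots,v_n\in K^{n-b}$ (so $(u_i)$ represents $U_{m-a,m}$ and $(v_j)$ represents $U_{n-b,n}$). The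 generic tensor product of $U_{m-a,m}$ and $U_{n-b,n}$ is the matroid on $[m]\times[n]$ represented over $K$ by the vectors $u_i\otimes v_j$, $(i,j)\in[m]\times[n]$. *)

theory Defs
  imports
    Complex_Main
    "HOL-Library.Function_Algebras"
    "HOL-Library.Poly_Mapping"
    "HOL-Library.Nat_Bijection"
    "HOL-Computational_Algebra.Fraction_Field"
begin

section \<open>Matroids\<close>

text \<open>A value of type \<open>'a matroid\<close> is only the raw data of a ground set and a predicate for the
  independent sets; the axioms are stated by the predicate \<open>is_matroid\<close>.\<close>

datatype 'a matroid = Matroid (ground: "'a set") (indep: "'a set \<Rightarrow> bool")

definition is_matroid :: "'a matroid \<Rightarrow> bool" where
  "is_matroid M \<longleftrightarrow>
     finite (ground M) \<and>
     (\<forall>X. indep M X \<longrightarrow> X \<subseteq> ground M) \<and>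
     indep M {} \<and>
     (\<forall>X Y. indep M Y \<longrightarrow> X \<subseteq> Y \<longrightarrow> indep M X) \<and>
     (\<forall>X Y. indep M X \<longrightarrow> indep M Y \<longrightarrow> card X < card Y \<longrightarrow>
        (\<exists>y \<in> Y - X. indep M (insert y X)))"

definition matroid_rank :: "'a matroid \<Rightarrow> 'a set \<Rightarrow> nat" where
  "matroid_rank M X = Max (card ` {I. I \<subseteq> X \<and> indep M I})"

definition loopless :: "'a matroid \<Rightarrow> bool" where
  "loopless M \<longleftrightarrow> (\<forall>e \<in> ground M. indep M {e})"

definition matroid_restrict :: "'a matroid \<Rightarrow> 'a set \<Rightarrow> 'a matroid" where
  "matroid_restrict M S = Matroid (ground M \<inter> S) (\<lambda>X. X \<subseteq> S \<and> indep M X)"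

definition matroid_iso_via :: "('a \<Rightarrow> 'b) \<Rightarrow> 'a matroid \<Rightarrow> 'b matroid \<Rightarrow> bool" where
  "matroid_iso_via f M N \<longleftrightarrow>
     bij_betw f (ground M) (ground N) \<and>
     (\<forall>X \<subseteq> ground M. indep M X \<longleftrightarrow> indep N (f ` X))"

text \<open>The weak order: \<open>weak_le M N\<close> says that \<open>N\<close> is freer than \<open>M\<close>.\<close>

definition weak_le :: "'a matroid \<Rightarrow> 'a matroid \<Rightarrow> bool" where
  "weak_le M N \<longleftrightarrow> ground M = ground N \<and> (\<forall>X. indep M X \<longrightarrow> indep N X)"

definition uniform_matroid :: "nat \<Rightarrow> nat \<Rightarrow> nat matroid" where
  "uniform_matroid k m = Matroid {1..m} (\<lambda>X. X \<subseteq> {1..m} \<and> card X \<le> k)"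

section \<open>Tensor products\<close>

definition is_tensor_product ::
  "('a \<times> 'b) matroid \<Rightarrow> 'a matroid \<Rightarrow> 'b matroid \<Rightarrow> bool" where
  "is_tensor_product M M1 M2 \<longleftrightarrow>
     is_matroid M1 \<and> loopless M1 \<and> is_matroid M2 \<and> loopless M2 \<and>
     is_matroid M \<and> ground M = ground M1 \<times> ground M2 \<and>
     (\<forall>e1 \<in> ground M1. matroid_iso_via snd (matroid_restrict M ({e1} \<times> ground M2)) M2) \<and>
     (\<forall>e2 \<in> ground M2. matroid_iso_via fst (matroid_restrict M (ground M1 \<times> {e2})) M1) \<and>
     (\<forall>X1 \<subseteq> ground M1. \<forall>X2 \<subseteq> ground M2.
        matroid_rank M (X1 \<times> X2) = matroid_rank M1 X1 * matroid_rank M2 X2)"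

section \<open>Linear representability\<close>

text \<open>Vectors over a field \<open>'k\<close> are coordinate functions \<open>'c \<Rightarrow> 'k\<close> with pointwise addition
  and the following scalar multiplication.\<close>

definition fun_scale :: "'k::field \<Rightarrow> ('c \<Rightarrow> 'k) \<Rightarrow> ('c \<Rightarrow> 'k)" where
  "fun_scale c x = (\<lambda>p. c * x p)"

lemma vector_space_fun_scale: "vector_space fun_scale"
  by unfold_locales (auto simp: fun_scale_def fun_eq_iff algebra_simps)

text \<open>The independent sets are those \<open>X\<close> for which the \<^emph>\<open>family\<close> \<open>(w e)\<close>, \<open>e \<in> X\<close>, is linearly
  independent; hence the requirement that \<open>w\<close> be injective on \<open>X\<close>.\<close>

definition vector_matroid :: "'a set \<Rightarrow> ('a \<Rightarrow> 'c \<Rightarrow> 'k::field) \<Rightarrow> 'a matroid" where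
  "vector_matroid E w =
     Matroid E (\<lambda>X. X \<subseteq> E \<and> inj_on w X \<and> \<not> module.dependent fun_scale (w ` X))"

text \<open>Elements of \<open>k^d\<close> are the functions \<open>nat \<Rightarrow> 'k\<close> that vanish outside \<open>{1..d}\<close>.\<close>

definition representable_over :: "'k::field itself \<Rightarrow> 'a matroid \<Rightarrow> bool" where
  "representable_over TYPE('k) M \<longleftrightarrow>
     (\<exists>d. \<exists>w :: 'a \<Rightarrow> nat \<Rightarrow> 'k.
        (\<forall>e \<in> ground M. \<forall>p. p \<notin> {1..d} \<longrightarrow> w e p = 0) \<and> M = vector_matroid (ground M) w)"

section \<open>The generic tensor product\<close>

text \<open>Rational functions over the rationals in the indeterminates \<open>x\<^sub>0, x\<^sub>1, \<dots>\<close>: monomials are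
  finitely supported exponent functions \<open>nat \<Rightarrow>\<^sub>0 nat\<close>, and polynomials are finitely supported
  coefficient functions on monomials. The indeterminates form a countable pool, so that one
  field serves all \<open>m\<close>, \<open>n\<close>, \<open>a\<close>, \<open>b\<close>. Only finitely many of them occur in any given tensor
  product; linear independence over the field they generate is the same as linear independence
  over the field below.\<close>

type_synonym rat_fun = "((nat \<Rightarrow>\<^sub>0 nat) \<Rightarrow>\<^sub>0 rat) fract"

definition indet :: "nat \<Rightarrow> rat_fun" where
  "indet t = Fract (Poly_Mapping.single (Poly_Mapping.single t 1) 1) 1"

text \<open>The two families of indeterminates are disjoint because \<open>sum_encode\<close> and \<open>prod_encode\<close>
  are bijective.\<close>

definition generic_u :: "nat \<Rightarrow> nat \<Rightarrow> nat \<Rightarrow> rat_fun" where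
  "generic_u d i = (\<lambda>p. if p \<in> {1..d} then indet (sum_encode (Inl (prod_encode (i, p)))) else 0)"

definition generic_v :: "nat \<Rightarrow> nat \<Rightarrow> nat \<Rightarrow> rat_fun" where
  "generic_v d j = (\<lambda>q. if q \<in> {1..d} then indet (sum_encode (Inr (prod_encode (j, q)))) else 0)"

text \<open>The tensor product of coordinate vectors, in the basis of tensors of unit vectors.\<close>

definition tensor_vec :: "('c \<Rightarrow> 'k::field) \<Rightarrow> ('d \<Rightarrow> 'k) \<Rightarrow> ('c \<times> 'd \<Rightarrow> 'k)" where
  "tensor_vec x y = (\<lambda>(p, q). x p * y q)"

text \<open>\<open>generic_tensor_product k m l n\<close> is the generic tensor product of the uniform matroids of
  rank \<open>k\<close> on \<open>{1..m}\<close> and of rank \<open>l\<close> on \<open>{1..n}\<close>.\<close>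

definition generic_tensor_product :: "nat \<Rightarrow> nat \<Rightarrow> nat \<Rightarrow> nat \<Rightarrow> (nat \<times> nat) matroid" where
  "generic_tensor_product k m l n =
     vector_matroid ({1..m} \<times> {1..n}) (\<lambda>(i, j). tensor_vec (generic_u k i) (generic_v l j))"

end

theory Submission
  imports Defs
begin

text \<open>The generic tensor product is the freest one because every representation \<open>w\<close> of a tensor
  product of \<open>U\<^bsub>k,m\<^esub>\<close> and \<open>U\<^bsub>l,n\<^esub>\<close> over a field is, up to nonzero scalars, of the form
  \<open>w\<^bsub>ij\<^esub> = x\<^sub>i \<otimes> y\<^sub>j\<close>. A set that is independent for particular \<open>x\<close> and \<open>y\<close> remains
  independent when their coordinates are replaced by indeterminates over the rationals, in every
  characteristic: the relevant minors are integer polynomials, and one that does not vanish at a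
  point is not the zero polynomial. Specializing to unit vectors also yields the lower bound for
  the ranks in the generic tensor product; the upper bound comes from spanning sets of tensors.\<close>

section \<open>Linearly independent families\<close>

interpretation fs: vector_space "fun_scale :: 'k::field \<Rightarrow> ('c \<Rightarrow> 'k) \<Rightarrow> 'c \<Rightarrow> 'k"
  by (rule vector_space_fun_scale)

text \<open>Coefficients are indexed by the elements of \<open>X\<close> and not by the vectors, so
  a repeated vector makes the family dependent and no injectivity condition has to be carried
  along.\<close>

definition indep_family :: "'e set \<Rightarrow> ('e \<Rightarrow> 'c \<Rightarrow> 'k::field) \<Rightarrow> bool" where
  "indep_family X w \<longleftrightarrow> (\<forall>c. (\<forall>p. (\<Sum>e\<in>X. c e * w e p) = 0) \<longrightarrow> (\<forall>e\<in>X. c e = 0))"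

lemma indep_familyI:
  "(\<And>c e. (\<And>p. (\<Sum>e\<in>X. c e * w e p) = 0) \<Longrightarrow> e \<in> X \<Longrightarrow> c e = 0) \<Longrightarrow> indep_family X w"
  by (auto simp: indep_family_def)

lemma indep_familyD:
  "indep_family X w \<Longrightarrow> (\<And>p. (\<Sum>e\<in>X. c e * w e p) = 0) \<Longrightarrow> e \<in> X \<Longrightarrow> c e = 0"
  by (auto simp: indep_family_def)

lemma sum_apply: "(\<Sum>e\<in>X. f e) p = (\<Sum>e\<in>X. f e p)"
  by (induction X rule: infinite_finite_induct) auto

text \<open>Used to view the vectors on a fibre \<open>X \<times> {j}\<close> or
  \<open>{i} \<times> X\<close> as a family indexed by \<open>X\<close> alone.\<close>

lemma indep_family_reindex:
  assumes h: "inj_on h Z"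
  shows "indep_family (h ` Z) w \<longleftrightarrow> indep_family Z (\<lambda>e. w (h e))"
proof
  assume *: "indep_family (h ` Z) w"
  show "indep_family Z (\<lambda>e. w (h e))"
  proof (rule indep_familyI)
    fix c e assume c: "\<And>p. (\<Sum>e\<in>Z. c e * w (h e) p) = 0" and e: "e \<in> Z"
    have "(\<Sum>e\<in>h ` Z. c (inv_into Z h e) * w e p) = 0" for p
      using h c by (simp add: sum.reindex)
    from indep_familyD[OF * this, of "h e"] show "c e = 0" using e h by simp
  qed
next
  assume *: "indep_family Z (\<lambda>e. w (h e))"
  show "indep_family (h ` Z) w"
  proof (rule indep_familyI)
    fix c e assume c: "\<And>p. (\<Sum>e\<in>h ` Z. c e * w e p) = 0" and e: "e \<in> h ` Z"
    then obtain z where z: "z \<in> Z" "e = h z" by auto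
    have "(\<Sum>e\<in>Z. c (h e) * w (h e) p) = 0" for p
      using c[of p] h by (simp add: sum.reindex)
    from indep_familyD[OF * this z(1)] show "c e = 0" using z by simp
  qed
qed

text \<open>Bridge between the library notion of independent sets of vectors and coefficient
  relations on families. Relations are carried over by reindexing sums along the injective
  \<open>w\<close>.\<close>

lemma indep_family_iff:
  fixes w :: "'e \<Rightarrow> 'c \<Rightarrow> 'k::field"
  assumes X: "finite X"
  shows "inj_on w X \<and> \<not> fs.dependent (w ` X) \<longleftrightarrow> indep_family X w"
proof (intro iffI conjI)
  assume *: "inj_on w X \<and> \<not> fs.dependent (w ` X)"
  show "indep_family X w"
  proof (rule indep_familyI)
    fix c e assume c: "\<And>p. (\<Sum>e\<in>X. c e * w e p) = 0" and e: "e \<in> X"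
    have "(\<Sum>v\<in>w ` X. fun_scale (c (inv_into X w v)) v) = (\<Sum>e\<in>X. fun_scale (c e) (w e))"
      using * by (subst sum.reindex) auto
    also have "\<dots> = 0"
      using c by (simp add: fun_eq_iff sum_apply fun_scale_def)
    finally have "c (inv_into X w (w e)) = 0"
      using fs.independentD[of "w ` X" "w ` X" "\<lambda>v. c (inv_into X w v)" "w e"] * X e by auto
    then show "c e = 0" using * e by simp
  qed
next
  assume *: "indep_family X w"
  show inj: "inj_on w X"
  proof (rule inj_onI, rule ccontr)
    fix e e' assume e: "e \<in> X" "e' \<in> X" "w e = w e'" "e \<noteq> e'"
    \<comment> \<open>Two equal vectors at different indices satisfy the relation with coefficients
      1 and -1.\<close>
    let ?c = "\<lambda>i. if i = e then 1 else if i = e' then - 1 else (0::'k)"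
    have "(\<Sum>i\<in>X. ?c i * w i p) = 0" for p
    proof -
      have "(\<Sum>i\<in>X. ?c i * w i p) = (\<Sum>i\<in>{e, e'}. ?c i * w i p)"
        using X e by (intro sum.mono_neutral_right) auto
      then show ?thesis using e by simp
    qed
    from indep_familyD[OF * this e(1)] show False by simp
  qed
  show "\<not> fs.dependent (w ` X)"
  proof
    assume "fs.dependent (w ` X)"
    then obtain u e where u: "e \<in> X" "u (w e) \<noteq> 0" "(\<Sum>v\<in>w ` X. fun_scale (u v) v) = 0"
      using X by (auto simp: fs.dependent_finite)
    have "(\<Sum>e\<in>X. fun_scale (u (w e)) (w e)) = 0"
      using u(3) inj by (simp add: sum.reindex)
    then have "(\<Sum>e\<in>X. u (w e) * w e p) = 0" for p
      by (simp add: fun_eq_iff sum_apply fun_scale_def)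
    from indep_familyD[OF * this u(1)] u(2) show False by simp
  qed
qed

lemma indep_vector_matroid:
  "finite E \<Longrightarrow> indep (vector_matroid E w) X \<longleftrightarrow> X \<subseteq> E \<and> indep_family X w"
  using indep_family_iff[of X w] by (auto simp: vector_matroid_def intro: finite_subset)

lemma ground_vector_matroid [simp]: "ground (vector_matroid E w) = E"
  by (simp add: vector_matroid_def)

lemma vector_matroid_eqI:
  assumes "finite E" and "\<And>X. X \<subseteq> E \<Longrightarrow> indep_family X w \<longleftrightarrow> indep_family X w'"
  shows "vector_matroid E w = vector_matroid E w'"
  using assms by (intro matroid.expand) (auto simp: indep_vector_matroid fun_eq_iff)

text \<open>The exchange axiom is Steinitz: a larger independent set cannot lie in the span of a
  smaller one, and any of its vectors outside that span can be added.\<close>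

lemma is_matroid_vector_matroid:
  fixes w :: "'e \<Rightarrow> 'c \<Rightarrow> 'k::field"
  assumes E: "finite E"
  shows "is_matroid (vector_matroid E w)"
  unfolding is_matroid_def
proof (intro conjI allI impI)
  fix X Y assume "indep (vector_matroid E w) Y" "X \<subseteq> Y"
  then show "indep (vector_matroid E w) X"
    by (auto simp: vector_matroid_def intro: inj_on_subset dest: fs.dependent_mono[OF _ image_mono])
next
  fix X Y
  assume X: "indep (vector_matroid E w) X" and Y: "indep (vector_matroid E w) Y"
    and less: "card X < card Y"
  have fin: "finite X" "finite Y"
    using X Y E by (auto simp: vector_matroid_def intro: finite_subset)
  have "\<not> w ` Y \<subseteq> fs.span (w ` X)"
  proof
    assume "w ` Y \<subseteq> fs.span (w ` X)"
    then have "card (w ` Y) \<le> card (w ` X)"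
      using fs.independent_span_bound[of "w ` X" "w ` Y"] Y fin by (auto simp: vector_matroid_def)
    then show False using X Y less by (auto simp: vector_matroid_def card_image)
  qed
  then obtain y where y: "y \<in> Y" "w y \<notin> fs.span (w ` X)" by auto
  then have "w y \<notin> w ` X" using fs.span_base by blast
  moreover have "\<not> fs.dependent (insert (w y) (w ` X))"
    using y X by (auto simp: vector_matroid_def dest: fs.independent_insertI)
  ultimately show "\<exists>y\<in>Y - X. indep (vector_matroid E w) (insert y X)"
    using X Y y by (intro bexI[of _ y]) (auto simp: vector_matroid_def)
qed (use E in \<open>auto simp: vector_matroid_def fs.independent_empty\<close>)

section \<open>Rank and uniform matroids\<close>

lemma matroid_rank_eqI:
  assumes "finite (ground M)" "\<And>I. indep M I \<Longrightarrow> I \<subseteq> ground M"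
    and "J \<subseteq> X" "indep M J" "card J = r"
    and "\<And>I. I \<subseteq> X \<Longrightarrow> indep M I \<Longrightarrow> card I \<le> r"
  shows "matroid_rank M X = r"
  unfolding matroid_rank_def
proof (rule Max_eqI)
  have "{I. I \<subseteq> X \<and> indep M I} \<subseteq> Pow (ground M)" using assms(2) by auto
  then show "finite (card ` {I. I \<subseteq> X \<and> indep M I})"
    using assms(1) by (meson finite_Pow_iff finite_imageI finite_subset)
qed (use assms in auto)

lemma matroid_rank_attained:
  assumes "is_matroid M"
  obtains I where "I \<subseteq> X" "indep M I" "card I = matroid_rank M X"
proof -
  have "{I. I \<subseteq> X \<and> indep M I} \<subseteq> Pow (ground M)" using assms by (auto simp: is_matroid_def)
  then have "finite (card ` {I. I \<subseteq> X \<and> indep M I})"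
    using assms by (meson finite_Pow_iff finite_imageI finite_subset is_matroid_def)
  moreover have "card ` {I. I \<subseteq> X \<and> indep M I} \<noteq> {}" using assms by (auto simp: is_matroid_def)
  ultimately have "matroid_rank M X \<in> card ` {I. I \<subseteq> X \<and> indep M I}"
    unfolding matroid_rank_def by (rule Max_in)
  then show thesis using that by auto
qed

text \<open>This turns the rank formula (P2') into statements about independence of
  products.\<close>

lemma indep_iff_card_eq_rank:
  assumes M: "is_matroid M" and X: "X \<subseteq> ground M"
  shows "indep M X \<longleftrightarrow> card X = matroid_rank M X"
proof
  have fin: "finite X" using assms by (auto simp: is_matroid_def intro: finite_subset)
  obtain I where I: "I \<subseteq> X" "indep M I" "card I = matroid_rank M X"
    using matroid_rank_attained[OF M] by blast
  show "indep M X" if "card X = matroid_rank M X"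
    using that I fin by (metis card_subset_eq)
  show "card X = matroid_rank M X" if "indep M X"
    using M that fin
    by (intro matroid_rank_eqI[of M X X, symmetric]) (auto simp: is_matroid_def intro: card_mono)
qed

lemma indep_uniform [simp]: "indep (uniform_matroid k m) X \<longleftrightarrow> X \<subseteq> {1..m} \<and> card X \<le> k"
  and ground_uniform [simp]: "ground (uniform_matroid k m) = {1..m}"
  by (simp_all add: uniform_matroid_def)

lemma is_matroid_uniform: "is_matroid (uniform_matroid k m)"
  unfolding is_matroid_def
proof (intro conjI allI impI)
  fix X Y assume *: "indep (uniform_matroid k m) Y" "X \<subseteq> Y"
  then have "finite Y" by (auto intro: finite_subset[OF _ finite_atLeastAtMost])
  then have "card X \<le> card Y" using *(2) by (rule card_mono)
  then show "indep (uniform_matroid k m) X" using * by auto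
next
  fix X Y
  assume *: "indep (uniform_matroid k m) X" "indep (uniform_matroid k m) Y" "card X < card Y"
  then have fin: "finite X" "finite Y" by (auto intro: finite_subset[OF _ finite_atLeastAtMost])
  have "\<not> Y \<subseteq> X" using card_mono[OF fin(1), of Y] *(3) by auto
  then show "\<exists>y\<in>Y - X. indep (uniform_matroid k m) (insert y X)"
  proof -
    from \<open>\<not> Y \<subseteq> X\<close> obtain y where "y \<in> Y - X" by blast
    then show ?thesis using * fin by (intro bexI[of _ y]) auto
  qed
qed auto

lemma matroid_rank_uniform:
  assumes "X \<subseteq> {1..m}"
  shows "matroid_rank (uniform_matroid k m) X = min k (card X)"
proof -
  have fin: "finite X" using assms by (auto intro: finite_subset[OF _ finite_atLeastAtMost])
  obtain J where "J \<subseteq> X" "card J = min k (card X)"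
    using obtain_subset_with_card_n[of "min k (card X)" X] by auto
  then show ?thesis
    using assms fin by (intro matroid_rank_eqI[of _ J]) (auto intro: card_mono)
qed

section \<open>Specialization of indeterminates\<close>

text \<open>Fraction-free Gaussian elimination: a vanishing pivot under \<open>\<psi>\<close> would vanish under \<open>\<phi>\<close>.\<close>

lemma indep_family_specialize:
  fixes \<phi> :: "'r::comm_ring_1 \<Rightarrow> 'k::field" and \<psi> :: "'r \<Rightarrow> 'l::field"
  assumes \<phi>: "\<And>a b. \<phi> (a * b) = \<phi> a * \<phi> b" "\<And>a b. \<phi> (a - b) = \<phi> a - \<phi> b"
    and \<psi>: "\<And>a b. \<psi> (a * b) = \<psi> a * \<psi> b" "\<And>a b. \<psi> (a - b) = \<psi> a - \<psi> b"
    and ker: "\<And>a. \<psi> a = 0 \<Longrightarrow> \<phi> a = 0"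
    and "finite X" and "indep_family X (\<lambda>e p. \<phi> (F e p))"
  shows "indep_family X (\<lambda>e p. \<psi> (F e p))"
  using assms(6,7)
proof (induction X arbitrary: F rule: finite_induct)
  case empty
  then show ?case by (simp add: indep_family_def)
next
  case (insert e0 X)
  have neq: "e \<noteq> e0" if "e \<in> X" for e using that insert.hyps by auto
  have "\<exists>p. \<phi> (F e0 p) \<noteq> 0"
  proof (rule ccontr)
    assume *: "\<not> (\<exists>p. \<phi> (F e0 p) \<noteq> 0)"
    \<comment> \<open>If the row of \<open>e0\<close> were zero, the relation supported on
      \<open>e0\<close> alone would contradict independence.\<close>
    have "(\<Sum>e\<in>insert e0 X. (if e = e0 then 1 else 0) * \<phi> (F e p)) = 0" for p
      using insert.hyps * by (auto intro!: sum.neutral)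
    from indep_familyD[OF insert.prems this, of e0] show False by simp
  qed
  then obtain s where s: "\<phi> (F e0 s) \<noteq> 0" by blast
  then have s': "\<psi> (F e0 s) \<noteq> 0" using ker by blast
  \<comment> \<open>One elimination step with pivot \<open>F e0 s\<close>. Cross-multiplying clears
    column \<open>s\<close> without division, so the entries stay in the ring and both \<phi> and
    \<psi> apply to them.\<close>
  define G where "G e p = F e0 s * F e p - F e s * F e0 p" for e p
  have "indep_family X (\<lambda>e p. \<phi> (G e p))"
  proof (rule indep_familyI)
    fix c e assume c: "\<And>p. (\<Sum>e\<in>X. c e * \<phi> (G e p)) = 0" and e: "e \<in> X"
    \<comment> \<open>A relation among the reduced rows becomes one among the original rows after
      expanding \<open>G\<close>: every coefficient picks up the pivot, and the subtracted multiples
      of row \<open>e0\<close> are collected into its coefficient.\<close>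
    define d where "d i = (if i = e0 then - (\<Sum>e\<in>X. c e * \<phi> (F e s)) else c i * \<phi> (F e0 s))" for i
    have d: "d e0 = - (\<Sum>e\<in>X. c e * \<phi> (F e s))" "\<And>i. i \<in> X \<Longrightarrow> d i = c i * \<phi> (F e0 s)"
      using neq by (auto simp: d_def)
    have "(\<Sum>i\<in>insert e0 X. d i * \<phi> (F i p)) = 0" for p
    proof -
      have "(\<Sum>i\<in>insert e0 X. d i * \<phi> (F i p)) =
          - (\<Sum>e\<in>X. c e * \<phi> (F e s)) * \<phi> (F e0 p) + (\<Sum>i\<in>X. c i * \<phi> (F e0 s) * \<phi> (F i p))"
        using insert.hyps d by simp
      also have "\<dots> = (\<Sum>e\<in>X. c e * \<phi> (G e p))"
        by (simp add: G_def \<phi> algebra_simps sum_subtractf sum_distrib_left)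
      finally show ?thesis using c by simp
    qed
    from indep_familyD[OF insert.prems this, of e] e d(2)[OF e] s show "c e = 0" by simp
  qed
  from insert.IH[OF this] have IH: "indep_family X (\<lambda>e p. \<psi> (G e p))" .
  show ?case
  proof (rule indep_familyI)
    fix d e assume d: "\<And>p. (\<Sum>e\<in>insert e0 X. d e * \<psi> (F e p)) = 0" and e: "e \<in> insert e0 X"
    have d': "(\<Sum>e\<in>X. d e * \<psi> (F e p)) = - (d e0 * \<psi> (F e0 p))" for p
      using d[of p] insert.hyps by (simp add: eq_neg_iff_add_eq_0 add.commute)
    \<comment> \<open>Conversely, a relation among the original rows restricts to the reduced rows,
      since the two contributions of row \<open>e0\<close> cancel.\<close>
    have "(\<Sum>e\<in>X. d e * \<psi> (G e p)) = 0" for p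
    proof -
      have "(\<Sum>e\<in>X. d e * \<psi> (G e p)) =
          \<psi> (F e0 s) * (\<Sum>e\<in>X. d e * \<psi> (F e p)) - (\<Sum>e\<in>X. d e * \<psi> (F e s)) * \<psi> (F e0 p)"
        by (simp add: G_def \<psi> algebra_simps sum_subtractf sum_distrib_left)
      then show ?thesis by (simp add: d')
    qed
    from indep_familyD[OF IH this] have *: "d e = 0" if "e \<in> X" for e using that by blast
    \<comment> \<open>In column \<open>s\<close> only the term of \<open>e0\<close> is left, and its
      pivot is nonzero under \<psi>.\<close>
    then have "d e0 * \<psi> (F e0 s) = 0" using d'[of s] by simp
    then show "d e = 0" using s' e * by auto
  qed
qed

section \<open>Integer polynomials and their evaluation in commutative rings\<close>

definition monom_eval :: "(nat \<Rightarrow> 'r::comm_ring_1) \<Rightarrow> (nat \<Rightarrow>\<^sub>0 nat) \<Rightarrow> 'r" where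
  "monom_eval f \<mu> = (\<Prod>t\<in>Poly_Mapping.keys \<mu>. f t ^ Poly_Mapping.lookup \<mu> t)"

text \<open>The coefficients are integers, so that one polynomial can be evaluated in a field of any
  characteristic as well as in \<open>rat_fun\<close>.\<close>

definition int_poly_eval :: "(nat \<Rightarrow> 'r::comm_ring_1) \<Rightarrow> ((nat \<Rightarrow>\<^sub>0 nat) \<Rightarrow>\<^sub>0 int) \<Rightarrow> 'r" where
  "int_poly_eval f p =
     (\<Sum>\<mu>\<in>Poly_Mapping.keys p. of_int (Poly_Mapping.lookup p \<mu>) * monom_eval f \<mu>)"

text \<open>Indices outside the support contribute factors with exponent 0. Two monomials can
  therefore be evaluated over a common index set.\<close>

lemma monom_eval_superset:
  assumes "finite A" "Poly_Mapping.keys \<mu> \<subseteq> A"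
  shows "monom_eval f \<mu> = (\<Prod>t\<in>A. f t ^ Poly_Mapping.lookup \<mu> t)"
  unfolding monom_eval_def using assms
  by (intro prod.mono_neutral_left) (auto simp: in_keys_iff)

lemma monom_eval_add: "monom_eval f (\<mu> + \<nu>) = monom_eval f \<mu> * monom_eval f \<nu>"
proof -
  let ?A = "Poly_Mapping.keys \<mu> \<union> Poly_Mapping.keys \<nu>"
  have "Poly_Mapping.keys (\<mu> + \<nu>) \<subseteq> ?A" by (rule Poly_Mapping.keys_add)
  then show ?thesis
    by (simp add: monom_eval_superset[of ?A] lookup_add power_add prod.distrib)
qed

lemma int_poly_eval_superset:
  assumes "finite A" "Poly_Mapping.keys p \<subseteq> A"
  shows "int_poly_eval f p = (\<Sum>\<mu>\<in>A. of_int (Poly_Mapping.lookup p \<mu>) * monom_eval f \<mu>)"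
  unfolding int_poly_eval_def using assms
  by (intro sum.mono_neutral_left) (auto simp: in_keys_iff)

lemma int_poly_eval_diff: "int_poly_eval f (p - q) = int_poly_eval f p - int_poly_eval f q"
proof -
  let ?A = "Poly_Mapping.keys p \<union> Poly_Mapping.keys q"
  have "Poly_Mapping.keys (p - q) \<subseteq> ?A" by (rule keys_diff)
  then show ?thesis
    by (simp add: int_poly_eval_superset[of ?A] lookup_minus algebra_simps sum_subtractf)
qed

lemma int_poly_eval_frag_of [simp]: "int_poly_eval f (frag_of \<mu>) = monom_eval f \<mu>"
  by (simp add: int_poly_eval_def)

lemma int_poly_eval_zero [simp]: "int_poly_eval f 0 = 0"
  by (simp add: int_poly_eval_def)

text \<open>Both sides are additive in \<open>q\<close>, and the monomials generate the polynomials
  as an additive group, so \<open>frag_induction\<close> reduces the claim to two monomials.\<close>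

lemma int_poly_eval_frag_of_mult:
  "int_poly_eval f (frag_of \<mu> * q) = monom_eval f \<mu> * int_poly_eval f q"
  using subset_refl[of "Poly_Mapping.keys q"]
  by (induction rule: frag_induction)
    (simp_all add: mult_single monom_eval_add int_poly_eval_diff right_diff_distrib)

lemma int_poly_eval_mult: "int_poly_eval f (p * q) = int_poly_eval f p * int_poly_eval f q"
  using subset_refl[of "Poly_Mapping.keys p"]
  by (induction rule: frag_induction)
    (simp_all add: int_poly_eval_frag_of_mult int_poly_eval_diff left_diff_distrib)

definition int_var :: "nat \<Rightarrow> (nat \<Rightarrow>\<^sub>0 nat) \<Rightarrow>\<^sub>0 int" where
  "int_var t = frag_of (Poly_Mapping.single t 1)"

lemma int_poly_eval_var [simp]: "int_poly_eval f (int_var t) = f t"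
  by (simp add: int_var_def monom_eval_def)

section \<open>Algebraic independence of the indeterminates\<close>

lemma Fract_sum_one: "(\<Sum>x\<in>A. Fract (g x) 1) = Fract (\<Sum>x\<in>A. g x) 1"
  by (induction A rule: infinite_finite_induct) (auto simp: Zero_fract_def)

lemma Fract_prod_one: "(\<Prod>x\<in>A. Fract (g x) 1) = Fract (\<Prod>x\<in>A. g x) 1"
  by (induction A rule: infinite_finite_induct) (auto simp: One_fract_def)

lemma Fract_power_one: "Fract x 1 ^ n = Fract (x ^ n) 1"
  by (induction n) (auto simp: One_fract_def)

lemma Fract_of_int: "of_int c = Fract (of_int c) 1"
  by (cases c rule: int_diff_cases) (simp add: of_nat_fract)

lemma single_one_power:
  "Poly_Mapping.single \<mu> (1::'r::comm_semiring_1) ^ n = Poly_Mapping.single (\<Sum>_\<in>{..<n}. \<mu>) 1"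
  by (induction n) (simp_all add: mult_single add.commute)

lemma prod_single_one:
  "(\<Prod>t\<in>A. Poly_Mapping.single (h t) (1::'r::comm_semiring_1)) = Poly_Mapping.single (\<Sum>t\<in>A. h t) 1"
  by (induction A rule: infinite_finite_induct) (simp_all add: mult_single)

text \<open>Powers and products of the indeterminates add exponent functions, and the exponents at
  the individual indices add up to \<mu>.\<close>

lemma monom_eval_indet: "monom_eval indet \<mu> = Fract (Poly_Mapping.single \<mu> 1) 1"
proof -
  have "(\<Sum>_\<in>{..<n}. Poly_Mapping.single t 1) = Poly_Mapping.single t n" for n t :: nat
    by (induction n) (simp_all add: single_add[symmetric] del: sum_constant)
  then have "monom_eval indet \<mu> =
      Fract (Poly_Mapping.single (\<Sum>t\<in>Poly_Mapping.keys \<mu>. Poly_Mapping.single t (Poly_Mapping.lookup \<mu> t)) 1) 1"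
    by (simp add: monom_eval_def indet_def Fract_power_one Fract_prod_one single_one_power prod_single_one)
  also have "(\<Sum>t\<in>Poly_Mapping.keys \<mu>. Poly_Mapping.single t (Poly_Mapping.lookup \<mu> t)) = \<mu>"
    by (intro poly_mapping_eqI) (simp add: lookup_sum lookup_single when_def in_keys_iff)
  finally show ?thesis .
qed

text \<open>Evaluation at the indeterminates returns the polynomial itself with its coefficients
  embedded in the rationals, and this embedding is injective.\<close>

lemma int_poly_eval_indet_eq_0D:
  assumes "int_poly_eval indet p = 0"
  shows "p = 0"
proof -
  let ?P = "(\<Sum>\<mu>\<in>Poly_Mapping.keys p. of_int (Poly_Mapping.lookup p \<mu>) * Poly_Mapping.single \<mu> 1)
    :: (nat \<Rightarrow>\<^sub>0 nat) \<Rightarrow>\<^sub>0 rat"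
  have "int_poly_eval indet p = Fract ?P 1"
    by (simp add: int_poly_eval_def monom_eval_indet Fract_of_int Fract_sum_one)
  with assms have "?P = 0" by (simp add: Zero_fract_def eq_fract)
  then have "Poly_Mapping.lookup ?P \<mu> = 0" for \<mu> by simp
  moreover have "Poly_Mapping.lookup ?P \<mu> = of_int (Poly_Mapping.lookup p \<mu>)" for \<mu>
  proof -
    have "of_int c * Poly_Mapping.single \<nu> 1 = (Poly_Mapping.single \<nu> (of_int c) :: (nat \<Rightarrow>\<^sub>0 nat) \<Rightarrow>\<^sub>0 rat)" for c \<nu>
      by (simp add: single_of_int[symmetric] mult_single del: single_of_int)
    then show ?thesis
      by (simp add: lookup_sum lookup_single when_def in_keys_iff)
  qed
  ultimately show "p = 0" by (intro poly_mapping_eqI) auto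
qed

text \<open>Evaluation at the indeterminates has trivial kernel, which lies in the kernel of every
  other evaluation. The characteristic of \<open>'k\<close> does not enter.\<close>

lemma indep_family_indet:
  fixes f :: "nat \<Rightarrow> 'k::field"
  assumes "finite X" and "indep_family X (\<lambda>e p. int_poly_eval f (F e p))"
  shows "indep_family X (\<lambda>e p. int_poly_eval indet (F e p))"
proof (rule indep_family_specialize[where \<phi> = "int_poly_eval f" and F = F])
  show "int_poly_eval f a = 0" if "int_poly_eval indet a = 0" for a
    using int_poly_eval_indet_eq_0D[OF that] by simp
qed (simp_all only: int_poly_eval_mult int_poly_eval_diff assms)

text \<open>Both families are evaluations of one matrix of integer polynomials: at the entries of
  \<open>x\<close> and \<open>y\<close>, and at the indeterminates.\<close>

lemma indep_generic_tensor:
  fixes x y :: "nat \<Rightarrow> nat \<Rightarrow> 'k::field"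
  assumes X: "finite X"
    and ind: "indep_family X (\<lambda>(i, j) (p, q). if p \<in> {1..k} \<and> q \<in> {1..l} then x i p * y j q else 0)"
  shows "indep_family X (\<lambda>(i, j). tensor_vec (generic_u k i) (generic_v l j))"
proof -
  \<comment> \<open>The point of evaluation undoes the numbering of indeterminates used in
    \<open>generic_u\<close> and \<open>generic_v\<close>.\<close>
  define f where "f t = (case sum_decode t of Inl s \<Rightarrow> case_prod x (prod_decode s)
    | Inr s \<Rightarrow> case_prod y (prod_decode s))" for t
  define F where "F = (\<lambda>(i, j) (p, q). if p \<in> {1..k} \<and> q \<in> {1..l}
    then int_var (sum_encode (Inl (prod_encode (i, p)))) * int_var (sum_encode (Inr (prod_encode (j, q))))
    else 0)"
  have "(\<lambda>e p. int_poly_eval f (F e p)) =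
      (\<lambda>(i, j) (p, q). if p \<in> {1..k} \<and> q \<in> {1..l} then x i p * y j q else 0)"
    by (intro ext) (simp add: F_def f_def int_poly_eval_mult split: prod.split)
  with ind have "indep_family X (\<lambda>e p. int_poly_eval f (F e p))" by simp
  moreover have "(\<lambda>e p. int_poly_eval indet (F e p)) = (\<lambda>(i, j). tensor_vec (generic_u k i) (generic_v l j))"
    by (intro ext) (auto simp: F_def int_poly_eval_mult tensor_vec_def generic_u_def generic_v_def
      split: prod.split)
  ultimately show ?thesis using indep_family_indet[OF X, of f F] by (simp only:)
qed

section \<open>The generic tensor product\<close>

text \<open>Specializing the vectors on each side to distinct unit vectors makes the tensors
  distinct unit vectors as well.\<close>

lemma indep_generic_tensor_Times:
  assumes "finite X1" "finite X2" "card X1 \<le> k" "card X2 \<le> l"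
  shows "indep_family (X1 \<times> X2) (\<lambda>(i, j). tensor_vec (generic_u k i) (generic_v l j))"
proof -
  obtain \<sigma> where \<sigma>: "\<sigma> ` X1 \<subseteq> {1..k}" "inj_on \<sigma> X1"
    using card_le_inj[of X1 "{1..k}"] assms by auto
  obtain \<tau> where \<tau>: "\<tau> ` X2 \<subseteq> {1..l}" "inj_on \<tau> X2"
    using card_le_inj[of X2 "{1..l}"] assms by auto
  define x y :: "nat \<Rightarrow> nat \<Rightarrow> rat" where "x i p = of_bool (\<sigma> i = p)" and "y j q = of_bool (\<tau> j = q)"
    for i j p q
  have "indep_family (X1 \<times> X2) (\<lambda>(i, j) (p, q). if p \<in> {1..k} \<and> q \<in> {1..l} then x i p * y j q else 0)"
    (is "indep_family _ ?w")
  proof (rule indep_familyI)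
    fix c e assume c: "\<And>s. (\<Sum>e\<in>X1 \<times> X2. c e * ?w e s) = 0" and "e \<in> X1 \<times> X2"
    then obtain i j where e: "e = (i, j)" "i \<in> X1" "j \<in> X2" by auto
    \<comment> \<open>The coordinate (\<sigma> i, \<tau> j) isolates the coefficient of (i, j),
      since \<sigma> and \<tau> are injective.\<close>
    have "?w e' (\<sigma> i, \<tau> j) = of_bool (e' = e)" if "e' \<in> X1 \<times> X2" for e'
      using that e \<sigma> \<tau> by (auto simp: x_def y_def inj_on_eq_iff)
    then have "(\<Sum>e'\<in>X1 \<times> X2. c e' * ?w e' (\<sigma> i, \<tau> j)) = (\<Sum>e'\<in>X1 \<times> X2. c e' * of_bool (e' = e))"
      by (intro sum.cong) auto
    also have "\<dots> = c e"
      using e assms by (simp add: of_bool_def if_distrib cong: if_cong)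
    finally show "c e = 0" using c[of "(\<sigma> i, \<tau> j)"] by simp
  qed
  then show ?thesis using assms by (intro indep_generic_tensor) auto
qed

text \<open>By bilinearity: one induction over the span for each factor.\<close>

lemma tensor_vec_in_span:
  fixes x :: "'c \<Rightarrow> 'k::field" and y :: "'d \<Rightarrow> 'k"
  assumes "x \<in> fs.span A" "y \<in> fs.span B"
  shows "tensor_vec x y \<in> fs.span ((\<lambda>(a, b). tensor_vec a b) ` (A \<times> B))" (is "_ \<in> ?S")
  using assms(1)
proof (induction rule: fs.span_induct_alt)
  case base
  have "tensor_vec (0 :: 'c \<Rightarrow> 'k) y = 0" by (auto simp: tensor_vec_def fun_eq_iff)
  then show ?case by (simp only: fs.span_zero)
next
  case (step c a z)
  have "tensor_vec a y \<in> ?S"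
    using assms(2)
  proof (induction rule: fs.span_induct_alt)
    case base
    have "tensor_vec a (0 :: 'd \<Rightarrow> 'k) = 0" by (auto simp: tensor_vec_def fun_eq_iff)
    then show ?case by (simp only: fs.span_zero)
  next
    case (step c' b z')
    have "tensor_vec a (fun_scale c' b + z') = fun_scale c' (tensor_vec a b) + tensor_vec a z'"
      by (auto simp: tensor_vec_def fun_scale_def fun_eq_iff algebra_simps)
    moreover have "tensor_vec a b \<in> ?S"
      using step \<open>a \<in> A\<close> by (intro fs.span_base) auto
    ultimately show ?case using step.IH by (simp only: fs.span_add fs.span_scale)
  qed
  moreover have "tensor_vec (fun_scale c a + z) y = fun_scale c (tensor_vec a y) + tensor_vec z y"
    by (auto simp: tensor_vec_def fun_scale_def fun_eq_iff algebra_simps)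
  ultimately show ?case using step.IH by (simp only: fs.span_add fs.span_scale)
qed

text \<open>The vectors themselves serve when there are at most \<open>k\<close> of them, and
  otherwise the \<open>k\<close> unit vectors do.\<close>

lemma spanning_set_card_le_min:
  fixes u :: "'e \<Rightarrow> nat \<Rightarrow> 'k::field"
  assumes X: "finite X" and u: "\<And>i p. p \<notin> {1..k} \<Longrightarrow> u i p = 0"
  obtains A where "finite A" "card A \<le> min k (card X)" "u ` X \<subseteq> fs.span A"
proof (cases "card X \<le> k")
  case True
  show thesis
  proof (rule that)
    show "card (u ` X) \<le> min k (card X)"
      using True card_image_le[OF X, of u] by simp
    show "u ` X \<subseteq> fs.span (u ` X)" by (rule fs.span_superset)
  qed (use X in simp)
next
  case False
  define unit :: "nat \<Rightarrow> nat \<Rightarrow> 'k" where "unit s p = (if p = s then 1 else 0)" for s p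
  have "u i \<in> fs.span (unit ` {1..k})" for i
  proof -
    have "u i s * unit s p = (if p = s then u i s else 0)" for s p by (simp add: unit_def)
    then have "(\<Sum>s\<in>{1..k}. u i s * unit s p) = (if p \<in> {1..k} then u i p else 0)" for p
      by (simp only: sum.delta' finite_atLeastAtMost)
    then have "(\<Sum>s\<in>{1..k}. u i s * unit s p) = u i p" for p
      by (cases "p \<in> {1..k}") (simp_all only: if_True if_False u not_False_eq_True)
    then have "u i = (\<Sum>s\<in>{1..k}. fun_scale (u i s) (unit s))"
      by (simp add: fun_eq_iff sum_apply fun_scale_def)
    also have "\<dots> \<in> fs.span (unit ` {1..k})"
      by (intro fs.span_sum fs.span_scale fs.span_base) auto
    finally show ?thesis .
  qed
  then have "u ` X \<subseteq> fs.span (unit ` {1..k})" by blast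
  moreover have "card (unit ` {1..k}) \<le> min k (card X)"
    using False card_image_le[of "{1..k}" unit] by simp
  ultimately show thesis by (intro that[of "unit ` {1..k}"]) simp_all
qed

text \<open>Tensors of two spanning sets span all the tensors in question, and an independent set is
  no larger than a spanning one.\<close>

lemma card_le_if_indep_generic_tensor:
  assumes X: "finite X1" "finite X2" and I: "I \<subseteq> X1 \<times> X2"
    and ind: "indep_family I (\<lambda>(i, j). tensor_vec (generic_u k i) (generic_v l j))"
  shows "card I \<le> min k (card X1) * min l (card X2)"
proof -
  let ?w = "\<lambda>(i, j). tensor_vec (generic_u k i) (generic_v l j)"
  obtain A where A: "finite A" "card A \<le> min k (card X1)" "generic_u k ` X1 \<subseteq> fs.span A"
    by (rule spanning_set_card_le_min[OF X(1), of k "generic_u k"]) (simp add: generic_u_def split: if_split, blast)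
  obtain B where B: "finite B" "card B \<le> min l (card X2)" "generic_v l ` X2 \<subseteq> fs.span B"
    by (rule spanning_set_card_le_min[OF X(2), of l "generic_v l"]) (auto simp: generic_v_def)
  have fin: "finite I" using finite_subset[OF I] X by simp
  then have *: "inj_on ?w I" "\<not> fs.dependent (?w ` I)"
    using indep_family_iff[of I ?w] ind by auto
  let ?S = "(\<lambda>(a, b). tensor_vec a b) ` (A \<times> B)"
  have "?w ` I \<subseteq> fs.span ?S"
    using I A(3) B(3) by (auto intro!: tensor_vec_in_span)
  then have "card (?w ` I) \<le> card ?S"
    using fs.independent_span_bound[of ?S "?w ` I"] A B * by auto
  also have "\<dots> \<le> card (A \<times> B)" using A B by (intro card_image_le) auto
  also have "\<dots> \<le> min k (card X1) * min l (card X2)"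
    using A(2) B(2) by (simp only: card_cartesian_product mult_le_mono)
  finally show ?thesis using * by (simp add: card_image)
qed

lemma ground_generic_tensor_product [simp]:
  "ground (generic_tensor_product k m l n) = {1..m} \<times> {1..n}"
  by (simp add: generic_tensor_product_def)

lemma is_matroid_generic_tensor_product: "is_matroid (generic_tensor_product k m l n)"
  by (simp add: generic_tensor_product_def is_matroid_vector_matroid)

lemma matroid_rank_generic_tensor_product:
  assumes "X1 \<subseteq> {1..m}" "X2 \<subseteq> {1..n}"
  shows "matroid_rank (generic_tensor_product k m l n) (X1 \<times> X2) = min k (card X1) * min l (card X2)"
proof -
  have fin: "finite X1" "finite X2"
    using assms finite_subset[OF _ finite_atLeastAtMost] by blast+
  obtain Y1 where Y1: "Y1 \<subseteq> X1" "card Y1 = min k (card X1)"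
    using obtain_subset_with_card_n[of "min k (card X1)" X1] by auto
  obtain Y2 where Y2: "Y2 \<subseteq> X2" "card Y2 = min l (card X2)"
    using obtain_subset_with_card_n[of "min l (card X2)" X2] by auto
  have "indep (generic_tensor_product k m l n) (Y1 \<times> Y2)"
    unfolding generic_tensor_product_def
    using Y1 Y2 assms fin finite_subset[OF Y1(1)] finite_subset[OF Y2(1)]
    by (subst indep_vector_matroid) (auto intro!: indep_generic_tensor_Times)
  moreover have "card I \<le> min k (card X1) * min l (card X2)"
    if "I \<subseteq> X1 \<times> X2" "indep (generic_tensor_product k m l n) I" for I
    using card_le_if_indep_generic_tensor[OF fin that(1)] that(2)
    by (simp add: generic_tensor_product_def indep_vector_matroid)
  ultimately show ?thesis
    using is_matroid_generic_tensor_product[of k m l n] Y1 Y2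
    by (intro matroid_rank_eqI[of _ "Y1 \<times> Y2"])
      (auto simp: is_matroid_def card_cartesian_product simp del: ground_generic_tensor_product)
qed

text \<open>The rank formula decides independence of every product set. A subset of a fibre is a
  product with a singleton, so (P1) follows from (P2').\<close>

lemma generic_tensor_product_is_tensor_product:
  assumes "0 < k" "0 < l"
  shows "is_tensor_product (generic_tensor_product k m l n) (uniform_matroid k m) (uniform_matroid l n)"
  unfolding is_tensor_product_def
proof (intro conjI ballI allI impI)
  let ?T = "generic_tensor_product k m l n"
  have iff: "indep ?T (X1 \<times> X2) \<longleftrightarrow> card X1 * card X2 = min k (card X1) * min l (card X2)"
    if "X1 \<subseteq> {1..m}" "X2 \<subseteq> {1..n}" for X1 X2
    using that by (subst indep_iff_card_eq_rank[OF is_matroid_generic_tensor_product])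
      (auto simp: matroid_rank_generic_tensor_product card_cartesian_product)
  fix e1 assume e1: "e1 \<in> ground (uniform_matroid k m)"
  show "matroid_iso_via snd (matroid_restrict ?T ({e1} \<times> ground (uniform_matroid l n))) (uniform_matroid l n)"
    unfolding matroid_iso_via_def
  proof (intro conjI allI impI)
    show "bij_betw snd (ground (matroid_restrict ?T ({e1} \<times> ground (uniform_matroid l n))))
        (ground (uniform_matroid l n))"
    proof -
      have "ground (matroid_restrict ?T ({e1} \<times> ground (uniform_matroid l n))) = {e1} \<times> {1..n}"
        using e1 by (auto simp: matroid_restrict_def)
      then show ?thesis by (auto simp: bij_betw_def inj_on_def)
    qed
    fix X assume X: "X \<subseteq> ground (matroid_restrict ?T ({e1} \<times> ground (uniform_matroid l n)))"
    then have X': "X \<subseteq> {e1} \<times> {1..n}" "snd ` X \<subseteq> {1..n}" by (auto simp: matroid_restrict_def)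
    have eq: "X = {e1} \<times> snd ` X" using X' by force
    \<comment> \<open>The singleton contributes \<open>min k 1\<close>, which is 1 because
      \<open>k\<close> is positive.\<close>
    have "indep ?T ({e1} \<times> snd ` X) \<longleftrightarrow> card (snd ` X) \<le> l"
      using e1 X' assms by (subst iff) auto
    then show "indep (matroid_restrict ?T ({e1} \<times> ground (uniform_matroid l n))) X =
        indep (uniform_matroid l n) (snd ` X)"
      using X' eq[symmetric] by (simp add: matroid_restrict_def)
  qed
next
  let ?T = "generic_tensor_product k m l n"
  have iff: "indep ?T (X1 \<times> X2) \<longleftrightarrow> card X1 * card X2 = min k (card X1) * min l (card X2)"
    if "X1 \<subseteq> {1..m}" "X2 \<subseteq> {1..n}" for X1 X2
    using that by (subst indep_iff_card_eq_rank[OF is_matroid_generic_tensor_product])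
      (auto simp: matroid_rank_generic_tensor_product card_cartesian_product)
  fix e2 assume e2: "e2 \<in> ground (uniform_matroid l n)"
  show "matroid_iso_via fst (matroid_restrict ?T (ground (uniform_matroid k m) \<times> {e2})) (uniform_matroid k m)"
    unfolding matroid_iso_via_def
  proof (intro conjI allI impI)
    show "bij_betw fst (ground (matroid_restrict ?T (ground (uniform_matroid k m) \<times> {e2})))
        (ground (uniform_matroid k m))"
    proof -
      have "ground (matroid_restrict ?T (ground (uniform_matroid k m) \<times> {e2})) = {1..m} \<times> {e2}"
        using e2 by (auto simp: matroid_restrict_def)
      then show ?thesis by (auto simp: bij_betw_def inj_on_def)
    qed
    fix X assume X: "X \<subseteq> ground (matroid_restrict ?T (ground (uniform_matroid k m) \<times> {e2}))"
    then have X': "X \<subseteq> {1..m} \<times> {e2}" "fst ` X \<subseteq> {1..m}" by (auto simp: matroid_restrict_def)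
    have eq: "X = fst ` X \<times> {e2}" using X' by force
    have "indep ?T (fst ` X \<times> {e2}) \<longleftrightarrow> card (fst ` X) \<le> k"
      using e2 X' assms by (subst iff) auto
    then show "indep (matroid_restrict ?T (ground (uniform_matroid k m) \<times> {e2})) X =
        indep (uniform_matroid k m) (fst ` X)"
      using X' eq[symmetric] by (simp add: matroid_restrict_def)
  qed
next
  fix X1 X2 assume "X1 \<subseteq> ground (uniform_matroid k m)" "X2 \<subseteq> ground (uniform_matroid l n)"
  then show "matroid_rank (generic_tensor_product k m l n) (X1 \<times> X2) =
      matroid_rank (uniform_matroid k m) X1 * matroid_rank (uniform_matroid l n) X2"
    by (simp add: matroid_rank_generic_tensor_product matroid_rank_uniform)
qed (use assms in \<open>auto simp: loopless_def is_matroid_uniform is_matroid_generic_tensor_product\<close>)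

lemma representable_generic_tensor_product:
  "representable_over TYPE(rat_fun) (generic_tensor_product k m l n)"
proof -
  let ?W = "\<lambda>(i, j). tensor_vec (generic_u k i) (generic_v l j)"
  have "card {1..k * l} = card ({1..k} \<times> {1..l})" by (simp add: card_cartesian_product)
  then obtain h where h: "bij_betw h {1..k * l} ({1..k} \<times> {1..l})"
    using finite_same_card_bij[of "{1..k * l}" "{1..k} \<times> {1..l}"] by auto
  \<comment> \<open>Representability asks for coordinates numbered by naturals, so the coordinate
    grid is enumerated by \<open>h\<close>. Outside the grid all tensors vanish and nothing is
    lost.\<close>
  define w where "w e r = (if r \<in> {1..k * l} then ?W e (h r) else 0)" for e r
  have zero: "?W e s = 0" if "s \<notin> {1..k} \<times> {1..l}" for e s
    using that by (auto simp: tensor_vec_def generic_u_def generic_v_def split: prod.splits)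
  have "indep_family X ?W \<longleftrightarrow> indep_family X w" for X
  proof -
    have "(\<forall>s. (\<Sum>e\<in>X. c e * ?W e s) = 0) \<longleftrightarrow> (\<forall>r. (\<Sum>e\<in>X. c e * w e r) = 0)" for c
    proof (intro iffI allI)
      fix s assume *: "\<forall>r. (\<Sum>e\<in>X. c e * w e r) = 0"
      show "(\<Sum>e\<in>X. c e * ?W e s) = 0"
      proof (cases "s \<in> {1..k} \<times> {1..l}")
        case True
        then have "s \<in> h ` {1..k * l}" using h by (simp only: bij_betw_def)
        then obtain r where "r \<in> {1..k * l}" "s = h r" by blast
        then show ?thesis using *[rule_format, of r] by (simp add: w_def)
      next
        case False
        then show ?thesis using zero[OF False] by (simp del: split_paired_All)
      qed
    next
      fix r assume *: "\<forall>s. (\<Sum>e\<in>X. c e * ?W e s) = 0"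
      show "(\<Sum>e\<in>X. c e * w e r) = 0"
        using *[rule_format, of "h r"] by (cases "r \<in> {1..k * l}")
          (simp_all only: w_def if_True if_False mult_zero_right sum.neutral_const)
    qed
    then show ?thesis by (simp only: indep_family_def)
  qed
  then have "generic_tensor_product k m l n = vector_matroid ({1..m} \<times> {1..n}) w"
    unfolding generic_tensor_product_def by (intro vector_matroid_eqI) auto
  then show ?thesis
    unfolding representable_over_def
    by (intro exI[of _ "k * l"] exI[of _ w]) (auto simp: w_def)
qed

section \<open>Representable tensor products of uniform matroids\<close>

text \<open>The index \<open>i\<close> together with the first \<open>k\<close> indices forms a
  circuit: a relation exists, and no coefficient of it vanishes, as it would otherwise live on
  \<open>k\<close> independent vectors. Solving for \<open>f i\<close> gives the expansion.\<close>

lemma uniform_circuit_coeffs: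
  fixes f :: "nat \<Rightarrow> 'c \<Rightarrow> 'k::field"
  assumes f: "\<And>X. X \<subseteq> {1..m} \<Longrightarrow> indep_family X f \<longleftrightarrow> card X \<le> k"
    and i: "k < i" "i \<le> m"
  shows "\<exists>A. (\<forall>t. f i t = (\<Sum>p\<in>{1..k}. A p * f p t)) \<and> (\<forall>p\<in>{1..k}. A p \<noteq> 0)"
proof -
  let ?X = "insert i {1..k}"
  have X: "?X \<subseteq> {1..m}" and card: "card ?X = Suc k" using i by auto
  then have "\<not> indep_family ?X f" using f[of ?X] by simp
  then obtain c e0 where c: "\<And>t. (\<Sum>e\<in>?X. c e * f e t) = 0" "e0 \<in> ?X" "c e0 \<noteq> 0"
    unfolding indep_family_def by blast
  have nz: "c e \<noteq> 0" if e: "e \<in> ?X" for e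
  proof
    assume "c e = 0"
    have sum0: "(\<Sum>e'\<in>?X - {e}. c e' * f e' t) = 0" for t
    proof -
      have "(\<Sum>e'\<in>?X. c e' * f e' t) = c e * f e t + (\<Sum>e'\<in>?X - {e}. c e' * f e' t)"
        by (rule sum.remove[OF _ e]) simp
      then show ?thesis by (simp only: c(1) \<open>c e = 0\<close> mult_zero_left add_0)
    qed
    have "card (?X - {e}) = k"
      using card by (simp only: card_Diff_singleton[OF e] diff_Suc_1)
    then have ind: "indep_family (?X - {e}) f"
      using f[OF order_trans[OF Diff_subset X], of "{e}"] by (simp only: order_refl)
    have "c e' = 0" if "e' \<in> ?X - {e}" for e'
      by (rule indep_familyD[OF ind sum0 that])
    then show False using c(2,3) \<open>c e = 0\<close> by (cases "e0 = e") blast+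
  qed
  show ?thesis
  proof (intro exI conjI allI ballI)
    show "f i t = (\<Sum>p\<in>{1..k}. - (c p / c i) * f p t)" for t
    proof -
      have "c i * f i t + (\<Sum>p\<in>{1..k}. c p * f p t) = 0"
        using c(1)[of t] i by simp
      then have "f i t = - (\<Sum>p\<in>{1..k}. c p * f p t) / c i"
        using nz[of i] by (simp add: field_simps add_eq_0_iff)
      also have "\<dots> = (\<Sum>p\<in>{1..k}. - (c p / c i) * f p t)"
        by (simp add: sum_divide_distrib sum_negf)
      finally show ?thesis .
    qed
    show "- (c p / c i) \<noteq> 0" if "p \<in> {1..k}" for p using nz that by simp
  qed
qed

text \<open>A vector outside the chosen basis rows and columns has two expansions, through its row and
  through its column; comparing them forces the coefficients to factor.\<close>

lemma tensor_decomposition: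
  fixes w :: "nat \<times> nat \<Rightarrow> 'c \<Rightarrow> 'k::field"
  assumes row: "\<And>j X. j \<in> {1..n} \<Longrightarrow> X \<subseteq> {1..m} \<Longrightarrow> indep_family X (\<lambda>i. w (i, j)) \<longleftrightarrow> card X \<le> k"
    and col: "\<And>i X. i \<in> {1..m} \<Longrightarrow> X \<subseteq> {1..n} \<Longrightarrow> indep_family X (\<lambda>j. w (i, j)) \<longleftrightarrow> card X \<le> l"
    and basis: "indep_family ({1..k} \<times> {1..l}) w"
    and kl: "0 < k" "k < m" "0 < l" "l < n"
  shows "\<exists>x y c b. \<forall>i\<in>{1..m}. \<forall>j\<in>{1..n}. c i j \<noteq> 0 \<and>
    (\<forall>t. w (i, j) t = c i j * (\<Sum>p\<in>{1..k}. \<Sum>q\<in>{1..l}. x i p * y j q * b p q t))"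
proof -
  let ?P = "\<lambda>j i f. (\<forall>t. w (i, j) t = (\<Sum>p\<in>{1..k}. f p * w (p, j) t)) \<and> (\<forall>p\<in>{1..k}. f p \<noteq> 0)"
  have ex_A: "\<exists>f. ?P j i f"
    if ji: "j \<in> {1..n}" "i \<in> {k<..m}" for i j
  proof -
    have i: "k < i" "i \<le> m" using ji by auto
    show ?thesis by (rule uniform_circuit_coeffs[OF row[OF ji(1)] i])
  qed
  \<comment> \<open>\<open>A j i\<close> expands \<open>w (i, j)\<close> in the vectors
    \<open>w (p, j)\<close> with \<open>p \<le> k\<close>; \<open>B i j\<close> below expands it in
    the vectors \<open>w (i, q)\<close> with \<open>q \<le> l\<close>.\<close>
  define A where "A j i = (SOME f. ?P j i f)" for j i
  have "?P j i (A j i)" if "j \<in> {1..n}" "i \<in> {k<..m}" for i j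
    unfolding A_def by (rule someI_ex[OF ex_A[OF that]])
  then have
    A: "\<And>i j t. j \<in> {1..n} \<Longrightarrow> i \<in> {k<..m} \<Longrightarrow> w (i, j) t = (\<Sum>p\<in>{1..k}. A j i p * w (p, j) t)"
    and A0: "\<And>i j p. j \<in> {1..n} \<Longrightarrow> i \<in> {k<..m} \<Longrightarrow> p \<in> {1..k} \<Longrightarrow> A j i p \<noteq> 0"
    by blast+
  let ?Q = "\<lambda>i j f. (\<forall>t. w (i, j) t = (\<Sum>q\<in>{1..l}. f q * w (i, q) t)) \<and> (\<forall>q\<in>{1..l}. f q \<noteq> 0)"
  have ex_B: "\<exists>f. ?Q i j f"
    if ij: "i \<in> {1..m}" "j \<in> {l<..n}" for i j
  proof -
    have j: "l < j" "j \<le> n" using ij by auto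
    show ?thesis by (rule uniform_circuit_coeffs[OF col[OF ij(1)] j])
  qed
  define B where "B i j = (SOME f. ?Q i j f)" for i j
  have "?Q i j (B i j)" if "i \<in> {1..m}" "j \<in> {l<..n}" for i j
    unfolding B_def by (rule someI_ex[OF ex_B[OF that]])
  then have
    B: "\<And>i j t. i \<in> {1..m} \<Longrightarrow> j \<in> {l<..n} \<Longrightarrow> w (i, j) t = (\<Sum>q\<in>{1..l}. B i j q * w (i, q) t)"
    and B0: "\<And>i j q. i \<in> {1..m} \<Longrightarrow> j \<in> {l<..n} \<Longrightarrow> q \<in> {1..l} \<Longrightarrow> B i j q \<noteq> 0"
    by blast+
  \<comment> \<open>Expanding in one index and then in the other, in both orders, writes
    \<open>w (i, j)\<close> twice in the corner vectors \<open>w (p, q)\<close>. These are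
    independent, so coefficients agree.\<close>
  have AB: "B i j q * A q i p = A j i p * B p j q"
    if ij: "i \<in> {k<..m}" "j \<in> {l<..n}" and pq: "p \<in> {1..k}" "q \<in> {1..l}" for i j p q
  proof -
    have *: "(\<Sum>(p, q)\<in>{1..k} \<times> {1..l}. B i j q * A q i p * w (p, q) t) = w (i, j) t" for t
    proof -
      have "w (i, j) t = (\<Sum>q\<in>{1..l}. B i j q * (\<Sum>p\<in>{1..k}. A q i p * w (p, q) t))"
        using B[of i j t] A ij kl by simp
      also have "\<dots> = (\<Sum>p\<in>{1..k}. \<Sum>q\<in>{1..l}. B i j q * A q i p * w (p, q) t)"
        by (subst sum.swap) (simp add: sum_distrib_left mult.assoc)
      finally show ?thesis by (simp add: sum.cartesian_product)
    qed
    have **: "(\<Sum>(p, q)\<in>{1..k} \<times> {1..l}. A j i p * B p j q * w (p, q) t) = w (i, j) t" for t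
    proof -
      have "w (i, j) t = (\<Sum>p\<in>{1..k}. A j i p * (\<Sum>q\<in>{1..l}. B p j q * w (p, q) t))"
        using A[of j i t] B ij kl by simp
      then show ?thesis by (simp add: sum.cartesian_product sum_distrib_left mult.assoc)
    qed
    have "(\<Sum>e\<in>{1..k} \<times> {1..l}. (case e of (p, q) \<Rightarrow> B i j q * A q i p - A j i p * B p j q) * w e t) =
        (\<Sum>(p, q)\<in>{1..k} \<times> {1..l}. B i j q * A q i p * w (p, q) t)
        - (\<Sum>(p, q)\<in>{1..k} \<times> {1..l}. A j i p * B p j q * w (p, q) t)" for t
      by (simp only: sum_subtractf[symmetric]) (intro sum.cong; auto simp: algebra_simps)
    then have "(\<Sum>e\<in>{1..k} \<times> {1..l}. (case e of (p, q) \<Rightarrow> B i j q * A q i p - A j i p * B p j q) * w e t) = 0" for t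
      by (simp only: * ** diff_self)
    from indep_familyD[OF basis this, of "(p, q)"] pq show ?thesis by simp
  qed
  \<comment> \<open>Inside the corner the factors are unit vectors. Outside it the last indices
    \<open>n\<close> and \<open>m\<close> serve as references, and the factors
    \<open>B p n q\<close> are absorbed into the basis \<open>b\<close>. The scalar
    \<open>c i j\<close> collects the ratios that depend on \<open>i\<close> and \<open>j\<close>
    only.\<close>
  define x where "x i p = (if i \<le> k then of_bool (i = p) else A n i p)" for i p
  define y where "y j q = (if j \<le> l then of_bool (j = q) else B m j q / B m n q)" for j q
  define b where "b p q t = B p n q * w (p, q) t" for p q t
  define c where "c i j =
    (if j \<le> l then 1 / B i n j
     else if i \<le> k then A n m i / A j m i
     else A j i 1 * A n m 1 / (A j m 1 * A n i 1))" for i j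
  have mn: "m \<in> {k<..m}" "m \<in> {1..m}" "n \<in> {l<..n}" "n \<in> {1..n}" "1 \<in> {1..k}" using kl by auto
  \<comment> \<open>For a second index in the corner, \<open>AB\<close> with \<open>j = n\<close>
    replaces \<open>A q i p\<close> by the reference \<open>A n i p\<close>, up to the factor
    \<open>B i n q\<close>.\<close>
  have left: "w (i, q) t = (\<Sum>p\<in>{1..k}. x i p * b p q t) / B i n q"
    if i: "i \<in> {1..m}" and q: "q \<in> {1..l}" for i q t
  proof (cases "i \<le> k")
    case True
    then have "(\<Sum>p\<in>{1..k}. x i p * b p q t) = (\<Sum>p\<in>{1..k}. if i = p then b p q t else 0)"
      by (intro sum.cong) (auto simp: x_def)
    also have "\<dots> = b i q t" using True i by simp
    finally show ?thesis using B0[OF i mn(3) q] by (simp add: b_def)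
  next
    case False
    then have i': "i \<in> {k<..m}" using i by simp
    have "w (i, q) t = (\<Sum>p\<in>{1..k}. A q i p * w (p, q) t)"
      using A[of q i t] i' q kl by simp
    also have "\<dots> = (\<Sum>p\<in>{1..k}. x i p * b p q t / B i n q)"
    proof (rule sum.cong)
      fix p assume p: "p \<in> {1..k}"
      show "A q i p * w (p, q) t = x i p * b p q t / B i n q"
        using AB[OF i' mn(3) p q] B0[OF i mn(3) q] False
        by (simp add: x_def b_def field_simps)
    qed simp
    finally show ?thesis by (simp add: sum_divide_distrib)
  qed
  \<comment> \<open>Dividing \<open>AB\<close> at (m, j) by \<open>AB\<close> at (m, n) cancels
    \<open>A q m p\<close>. The dependence on \<open>q\<close> is then \<open>y j q\<close> times
    \<open>B p n q\<close>.\<close>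
  have right: "B p j q = A n m p / A j m p * y j q * B p n q"
    if j: "j \<in> {l<..n}" and p: "p \<in> {1..k}" and q: "q \<in> {1..l}" for j p q
  proof -
    have nz: "A j m p \<noteq> 0" "B m n q \<noteq> 0" "A q m p \<noteq> 0"
      using A0[of j m p] B0[of m n q] A0[of q m p] mn p q j kl by auto
    have "B p j q = B m j q * A q m p / A j m p"
      using AB[OF mn(1) j p q] nz by (simp add: field_simps)
    also have "A q m p = A n m p * B p n q / B m n q"
      using AB[OF mn(1) mn(3) p q] nz by (simp add: field_simps)
    finally show ?thesis using j by (simp add: y_def ac_simps)
  qed
  show ?thesis
  proof (intro exI ballI conjI allI)
    fix i j assume i: "i \<in> {1..m}" and j: "j \<in> {1..n}"
    have swap: "(\<Sum>p\<in>{1..k}. \<Sum>q\<in>{1..l}. x i p * y j q * b p q t) =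
        (\<Sum>q\<in>{1..l}. y j q * (\<Sum>p\<in>{1..k}. x i p * b p q t))" for t
      by (subst sum.swap) (simp add: sum_distrib_left algebra_simps)
    show "w (i, j) t = c i j * (\<Sum>p\<in>{1..k}. \<Sum>q\<in>{1..l}. x i p * y j q * b p q t)" for t
    proof (cases "j \<le> l")
      case True
      have "(\<Sum>q\<in>{1..l}. y j q * (\<Sum>p\<in>{1..k}. x i p * b p q t)) =
          (\<Sum>q\<in>{1..l}. if j = q then \<Sum>p\<in>{1..k}. x i p * b p q t else 0)"
        using True by (intro sum.cong) (auto simp: y_def)
      also have "\<dots> = (\<Sum>p\<in>{1..k}. x i p * b p j t)" using True j by simp
      finally show ?thesis
        using True j by (subst left[OF i]) (simp_all only: swap c_def, simp_all)
    next
      case False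
      then have j': "j \<in> {l<..n}" using j by simp
      \<comment> \<open>For \<open>i > k\<close> the index \<open>p = 1\<close> is the reference:
        the ratio of \<open>B i j q\<close> to \<open>B i n q\<close> is that of
        \<open>B 1 j q\<close> to \<open>B 1 n q\<close>, up to a factor independent of
        \<open>q\<close>.\<close>
      have coeff: "B i j q = c i j * y j q * B i n q" if q: "q \<in> {1..l}" for q
      proof (cases "i \<le> k")
        case True
        then show ?thesis using right[OF j' _ q, of i] i False by (simp add: c_def)
      next
        case F: False
        then have i': "i \<in> {k<..m}" using i by simp
        have nz: "A q i 1 \<noteq> 0" "A n i 1 \<noteq> 0" "B 1 n q \<noteq> 0" "A j m 1 \<noteq> 0"
          using A0[of q i 1] A0[of n i 1] B0[of 1 n q] A0[of j m 1] mn i' j q kl by auto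
        have "B i j q = A j i 1 * B 1 j q / A q i 1"
          using AB[OF i' j' mn(5) q] nz by (simp add: field_simps)
        also have "A q i 1 = A n i 1 * B 1 n q / B i n q"
          using AB[OF i' mn(3) mn(5) q] B0[OF i mn(3) q] by (simp add: field_simps)
        also have "B 1 j q = A n m 1 / A j m 1 * y j q * B 1 n q"
          by (rule right[OF j' mn(5) q])
        finally show ?thesis using nz F False by (simp add: c_def field_simps)
      qed
      have "w (i, j) t = (\<Sum>q\<in>{1..l}. B i j q * w (i, q) t)"
        using B[OF i j'] .
      also have "\<dots> = (\<Sum>q\<in>{1..l}. c i j * (y j q * (\<Sum>p\<in>{1..k}. x i p * b p q t)))"
      proof (rule sum.cong)
        fix q assume q: "q \<in> {1..l}"
        show "B i j q * w (i, q) t = c i j * (y j q * (\<Sum>p\<in>{1..k}. x i p * b p q t))"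
          using B0[OF i mn(3) q] by (simp only: coeff[OF q] left[OF i q]) simp
      qed simp
      finally show ?thesis by (simp only: swap sum_distrib_left)
    qed
    show "c i j \<noteq> 0"
      using i j mn kl A0[of n m i] A0[of j m i] A0[of j i 1] A0[of n m 1] A0[of j m 1] A0[of n i 1]
        B0[of i n j]
      by (auto simp: c_def)
  qed
qed

section \<open>Comparison in the weak order\<close>

lemma indep_tensor_if_decomposition:
  fixes w :: "nat \<times> nat \<Rightarrow> 'c \<Rightarrow> 'k::field"
  assumes w: "\<And>i j t. (i, j) \<in> X \<Longrightarrow>
      w (i, j) t = c i j * (\<Sum>p\<in>{1..k}. \<Sum>q\<in>{1..l}. x i p * y j q * b p q t)"
    and c: "\<And>i j. (i, j) \<in> X \<Longrightarrow> c i j \<noteq> 0"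
    and ind: "indep_family X w"
  shows "indep_family X (\<lambda>(i, j) (p, q). if p \<in> {1..k} \<and> q \<in> {1..l} then x i p * y j q else 0)"
    (is "indep_family _ ?v")
proof (rule indep_familyI)
  fix d e assume d: "\<And>s. (\<Sum>e\<in>X. d e * ?v e s) = 0" and e: "e \<in> X"
  \<comment> \<open>The linear map sending the unit tensor at (p, q) to \<open>b p q\<close> carries
    a relation among the tensors to one among the vectors \<open>w e\<close>, once the coefficients
    are divided by the nonzero scalars.\<close>
  have "(\<Sum>e\<in>X. (d e / case_prod c e) * w e t) = 0" for t
  proof -
    have "(\<Sum>e\<in>X. (d e / case_prod c e) * w e t) =
        (\<Sum>e\<in>X. \<Sum>p\<in>{1..k}. \<Sum>q\<in>{1..l}. (d e * ?v e (p, q)) * b p q t)"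
    proof (rule sum.cong)
      fix e assume e: "e \<in> X"
      obtain i j where ij: "e = (i, j)" by (cases e)
      have "(d e / case_prod c e) * w e t = d e * (\<Sum>p\<in>{1..k}. \<Sum>q\<in>{1..l}. x i p * y j q * b p q t)"
        using w[of i j t] c[of i j] e by (simp add: ij)
      then show "(d e / case_prod c e) * w e t = (\<Sum>p\<in>{1..k}. \<Sum>q\<in>{1..l}. (d e * ?v e (p, q)) * b p q t)"
        by (simp add: ij sum_distrib_left mult.assoc)
    qed simp
    also have "\<dots> = (\<Sum>p\<in>{1..k}. \<Sum>q\<in>{1..l}. \<Sum>e\<in>X. (d e * ?v e (p, q)) * b p q t)"
      by (subst sum.swap, intro sum.cong refl, rule sum.swap)
    also have "\<dots> = (\<Sum>p\<in>{1..k}. \<Sum>q\<in>{1..l}. (\<Sum>e\<in>X. d e * ?v e (p, q)) * b p q t)"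
      by (simp only: sum_distrib_right)
    also have "\<dots> = 0" by (simp only: d mult_zero_left sum.neutral_const)
    finally show ?thesis .
  qed
  from indep_familyD[OF ind this e] show "d e = 0" using c e by (cases e) auto
qed

text \<open>A representation of \<open>M\<close> decomposes into scaled tensors, so a set
  independent in \<open>M\<close> is independent for the particular \<open>x\<close> and
  \<open>y\<close>, hence for indeterminates.\<close>

lemma weak_le_generic_tensor_product:
  assumes kl: "0 < k" "k < m" "0 < l" "l < n"
    and M: "is_tensor_product M (uniform_matroid k m) (uniform_matroid l n)"
    and rep: "representable_over TYPE('k::field) M"
  shows "weak_le M (generic_tensor_product k m l n)"
proof -
  have ground: "ground M = {1..m} \<times> {1..n}" and matroid: "is_matroid M"
    using M by (auto simp: is_tensor_product_def)
  obtain w :: "nat \<times> nat \<Rightarrow> nat \<Rightarrow> 'k" where "M = vector_matroid (ground M) w"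
    using rep by (auto simp: representable_over_def)
  then have M_eq: "M = vector_matroid ({1..m} \<times> {1..n}) w" using ground by simp
  have indep_M: "indep M X \<longleftrightarrow> X \<subseteq> {1..m} \<times> {1..n} \<and> indep_family X w" for X
    unfolding M_eq by (rule indep_vector_matroid) simp
  have row: "indep_family X (\<lambda>i. w (i, j)) \<longleftrightarrow> card X \<le> k" if j: "j \<in> {1..n}" and X: "X \<subseteq> {1..m}" for j X
  proof -
    have "matroid_iso_via fst (matroid_restrict M ({1..m} \<times> {j})) (uniform_matroid k m)"
      using M j by (simp add: is_tensor_product_def)
    moreover have "X \<times> {j} \<subseteq> ground (matroid_restrict M ({1..m} \<times> {j}))"
      using X j by (auto simp: matroid_restrict_def ground)
    ultimately have "indep (matroid_restrict M ({1..m} \<times> {j})) (X \<times> {j}) \<longleftrightarrow>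
        indep (uniform_matroid k m) (fst ` (X \<times> {j}))"
      unfolding matroid_iso_via_def by blast
    then have "indep_family (X \<times> {j}) w \<longleftrightarrow> card X \<le> k"
      using X j by (auto simp: matroid_restrict_def indep_M)
    moreover have "X \<times> {j} = (\<lambda>i. (i, j)) ` X" by auto
    ultimately show ?thesis
      using indep_family_reindex[of "\<lambda>i. (i, j)" X w] by (simp add: inj_on_def)
  qed
  have col: "indep_family X (\<lambda>j. w (i, j)) \<longleftrightarrow> card X \<le> l" if i: "i \<in> {1..m}" and X: "X \<subseteq> {1..n}" for i X
  proof -
    have "matroid_iso_via snd (matroid_restrict M ({i} \<times> {1..n})) (uniform_matroid l n)"
      using M i by (simp add: is_tensor_product_def)
    moreover have "{i} \<times> X \<subseteq> ground (matroid_restrict M ({i} \<times> {1..n}))"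
      using X i by (auto simp: matroid_restrict_def ground)
    ultimately have "indep (matroid_restrict M ({i} \<times> {1..n})) ({i} \<times> X) \<longleftrightarrow>
        indep (uniform_matroid l n) (snd ` ({i} \<times> X))"
      unfolding matroid_iso_via_def by blast
    then have "indep_family ({i} \<times> X) w \<longleftrightarrow> card X \<le> l"
      using X i by (auto simp: matroid_restrict_def indep_M)
    moreover have "{i} \<times> X = (\<lambda>j. (i, j)) ` X" by auto
    ultimately show ?thesis
      using indep_family_reindex[of "\<lambda>j. (i, j)" X w] by (simp add: inj_on_def)
  qed
  have sub: "{1..k} \<subseteq> {1..m}" "{1..l} \<subseteq> {1..n}" using kl by auto
  \<comment> \<open>By (P2') the corner has rank \<open>k * l\<close>, its cardinality, so its
    vectors are the independent family on which the decomposition rests.\<close>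
  have "matroid_rank M ({1..k} \<times> {1..l}) =
      matroid_rank (uniform_matroid k m) {1..k} * matroid_rank (uniform_matroid l n) {1..l}"
    using M sub by (auto simp only: is_tensor_product_def ground_uniform)
  then have "matroid_rank M ({1..k} \<times> {1..l}) = card ({1..k} \<times> {1..l})"
    using sub by (simp add: matroid_rank_uniform card_cartesian_product)
  moreover have "{1..k} \<times> {1..l} \<subseteq> ground M" using sub ground by auto
  ultimately have "indep M ({1..k} \<times> {1..l})" by (simp only: indep_iff_card_eq_rank[OF matroid])
  then have basis: "indep_family ({1..k} \<times> {1..l}) w" by (simp only: indep_M)
  have "\<exists>x y c b. \<forall>i\<in>{1..m}. \<forall>j\<in>{1..n}. c i j \<noteq> 0 \<and>
    (\<forall>t. w (i, j) t = c i j * (\<Sum>p\<in>{1..k}. \<Sum>q\<in>{1..l}. x i p * y j q * b p q t))"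
    by (rule tensor_decomposition[OF row col basis kl])
  then obtain x y c b where
    dec: "\<forall>i\<in>{1..m}. \<forall>j\<in>{1..n}. c i j \<noteq> 0 \<and>
      (\<forall>t. w (i, j) t = c i j * (\<Sum>p\<in>{1..k}. \<Sum>q\<in>{1..l}. x i p * y j q * b p q t))"
    by (elim exE)
  have "indep (generic_tensor_product k m l n) X" if "indep M X" for X
  proof -
    have X: "X \<subseteq> {1..m} \<times> {1..n}" "indep_family X w" using that indep_M by auto
    have "indep_family X (\<lambda>(i, j) (p, q). if p \<in> {1..k} \<and> q \<in> {1..l} then x i p * y j q else 0)"
    proof (rule indep_tensor_if_decomposition)
      fix i j assume "(i, j) \<in> X"
      then have ij: "i \<in> {1..m}" "j \<in> {1..n}" using X(1) by auto
      show "w (i, j) t = c i j * (\<Sum>p\<in>{1..k}. \<Sum>q\<in>{1..l}. x i p * y j q * b p q t)" for t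
        using dec ij by blast
      show "c i j \<noteq> 0" using dec ij by blast
    qed (rule X(2))
    moreover have "finite X" using finite_subset[OF X(1)] by simp
    ultimately show ?thesis
      using X by (simp add: generic_tensor_product_def indep_vector_matroid indep_generic_tensor)
  qed
  then show ?thesis by (simp add: weak_le_def ground)
qed

theorem corollary1p3:
  fixes a b m n :: nat
  assumes "a \<ge> 2" and "b \<ge> 2" and "m \<ge> a + 1" and "n \<ge> b + 1"
  shows "representable_over TYPE(rat_fun) (generic_tensor_product (m - a) m (n - b) n) \<and>
    is_tensor_product (generic_tensor_product (m - a) m (n - b) n)
      (uniform_matroid (m - a) m) (uniform_matroid (n - b) n) \<and>
    (\<forall>M. is_tensor_product M (uniform_matroid (m - a) m) (uniform_matroid (n - b) n) \<longrightarrow>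
         representable_over TYPE('k::field) M \<longrightarrow>
         weak_le M (generic_tensor_product (m - a) m (n - b) n))"
proof (intro conjI allI impI)
  \<comment> \<open>Positive ranks are needed for (P1); ranks below \<open>m\<close> and
    \<open>n\<close> leave the last indices \<open>m\<close> and \<open>n\<close> outside the
    corner, as references for the decomposition.\<close>
  have kl: "0 < m - a" "m - a < m" "0 < n - b" "n - b < n" using assms by auto
  show "representable_over TYPE(rat_fun) (generic_tensor_product (m - a) m (n - b) n)"
    by (rule representable_generic_tensor_product)
  show "is_tensor_product (generic_tensor_product (m - a) m (n - b) n)
      (uniform_matroid (m - a) m) (uniform_matroid (n - b) n)"
    using kl by (intro generic_tensor_product_is_tensor_product)
  show "weak_le M (generic_tensor_product (m - a) m (n - b) n)"
    if "is_tensor_product M (uniform_matroid (m - a) m) (uniform_matroid (n - b) n)"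
      and "representable_over TYPE('k) M" for M
    using weak_le_generic_tensor_product[OF kl that] .
qed

end
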